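(* Let $q=p^n>2$, where $p$ is a prime, and let $G=GL(2,q)$ be the general linear group of $2\times 2$ invertible matrices over the field with $q$ elements. Then $$\text{L-Spec}(\Gamma_G)=\{0^{q^2+q+1},\ (q^2-3q+2)^{\frac{q(q+1)(q^2-3q+1)}{2}},\ (q^2-q)^{\frac{q(q-1)(q^2-q-1)}{2}},\ (q^2-2q+1)^{q(q+1)(q-2)}\}$$ and $$\begin{aligned}\text{Q-Spec}(\Gamma_G)=\{&(2q^2-6q+2)^{\frac{q(q+1)}{2}},\ (q^2-3q)^{\frac{q(q+1)(q^2-3q+1)}{2}},\ (2q^2-2q-2)^{\frac{q(q-1)}{2}},\\ &(q^2-q-2)^{\frac{q(q-1)(q^2-q-1)}{2}},\ (2q^2-4q)^{q+1},\ (q^2-2q-1)^{q(q+1)(q-2)}\}.\end{aligned}$$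
   Context: The commuting graph $\Gamma_G$ of a finite non-abelian group $G$ with center $Z(G)$ is the simple undirected graph with vertex set $G\setminus Z(G)$ in which two distinct vertices $x,y$ are adjacent if and only if $xy=yx$. For a finite graph $\mathcal{G}$ with adjacency matrix $A$ and (diagonal) degree matrix $D$, $\text{L-Spec}(\mathcal{G})$ and $\text{Q-Spec}(\mathcal{G})$ denote the multisets of eigenvalues (with multiplicity) of the Laplacian matrix $D-A$ and of the signless Laplacian matrix $D+A$, respectively. The notation $\{\alpha_1^{a_1},\dots,\alpha_l^{a_l}\}$ means the multiset in which $\alpha_i$ is listed $a_i$ times (the outermost exponent is the multiplicity; if listed values coincide, their multiplicities add; an exponent $0$ means the value does not appear). *)

theory Defs
  imports
    "HOL-Library.Cardinality"
    "HOL-Algebra.Group"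
    "HOL-Computational_Algebra.Fundamental_Theorem_Algebra"
    "Jordan_Normal_Form.Char_Poly"
    "Graph_Theory.Pair_Digraph"
begin

definition general_linear_group :: "nat \<Rightarrow> 'a::field itself \<Rightarrow> 'a mat monoid" where
  "general_linear_group n ty = units_of (ring_mat ty n ())"

definition group_center :: "('g, 'b) monoid_scheme \<Rightarrow> 'g set" where
  "group_center G = {z \<in> carrier G. \<forall>x \<in> carrier G. x \<otimes>\<^bsub>G\<^esub> z = z \<otimes>\<^bsub>G\<^esub> x}"

text \<open>
  A simple undirected graph is represented as in \<open>Graph_Theory\<close>, by a symmetric loop-free
  relation on its vertices: each undirected edge contributes both of its orientations to
  \<^const>\<open>parcs\<close>, so \<^const>\<open>out_degree\<close> is the usual degree.
\<close>

definition commuting_graph :: "('g, 'b) monoid_scheme \<Rightarrow> 'g pair_pre_digraph" where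
  "commuting_graph G =
     \<lparr> pverts = carrier G - group_center G,
       parcs = {(x, y). x \<in> carrier G - group_center G \<and> y \<in> carrier G - group_center G \<and>
                        x \<noteq> y \<and> x \<otimes>\<^bsub>G\<^esub> y = y \<otimes>\<^bsub>G\<^esub> x} \<rparr>"

lemma pair_graph_commuting_graph:
  assumes "finite (carrier G)"
  shows "pair_graph (commuting_graph G)"
proof -
  have "parcs (commuting_graph G) \<subseteq> carrier G \<times> carrier G"
    by (auto simp: commuting_graph_def)
  then have "finite (parcs (commuting_graph G))"
    using assms by (meson finite_SigmaI finite_subset)
  with assms show ?thesis
    by unfold_locales
      (auto simp: commuting_graph_def symmetric_def sym_def)
qed

text \<open>
  Rows and columns of the matrices below are indexed by an arbitrary but fixed enumeration of
  the (finite) vertex set. A different enumeration conjugates them by a permutation matrix and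
  hence does not change the spectrum.
\<close>

definition vertex_list :: "'v pair_pre_digraph \<Rightarrow> 'v list" where
  "vertex_list \<G> = (SOME vs. distinct vs \<and> set vs = pverts \<G>)"

definition adjacency_matrix :: "'v pair_pre_digraph \<Rightarrow> complex mat" where
  "adjacency_matrix \<G> =
     (let vs = vertex_list \<G> in
      mat (length vs) (length vs) (\<lambda>(i, j). if (vs ! i, vs ! j) \<in> parcs \<G> then 1 else 0))"

definition degree_matrix :: "'v pair_pre_digraph \<Rightarrow> complex mat" where
  "degree_matrix \<G> =
     (let vs = vertex_list \<G> in
      mat (length vs) (length vs)
        (\<lambda>(i, j). if i = j then of_nat (out_degree (with_proj \<G>) (vs ! i)) else 0))"

text \<open>
  Over the complex numbers the characteristic polynomial splits, so the following multiset
  contains every eigenvalue with its full algebraic multiplicity. The matrices it is applied to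
  are real symmetric, hence this is also the geometric multiplicity.
\<close>

definition eigenvalue_mset :: "complex mat \<Rightarrow> complex multiset" where
  "eigenvalue_mset M = proots (char_poly M)"

definition L_Spec :: "'v pair_pre_digraph \<Rightarrow> complex multiset" where
  "L_Spec \<G> = eigenvalue_mset (degree_matrix \<G> - adjacency_matrix \<G>)"

definition Q_Spec :: "'v pair_pre_digraph \<Rightarrow> complex multiset" where
  "Q_Spec \<G> = eigenvalue_mset (degree_matrix \<G> + adjacency_matrix \<G>)"

end

theory Submission
  imports Defs
begin

text \<open>
  Two non-scalar matrices in \<open>GL(2, q)\<close> commute iff they give the same point of the projective
  plane of lines in \<open>M\<^sub>2(F)/F\<cdot>I\<close>. Hence commuting is transitive off the centre and the commuting
  graph is a disjoint union of cliques, one per point of the plane. The clique of \<open>X\<close> has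
  \<open>(q - 1)(q - k)\<close> vertices, where \<open>k \<in> {0, 1, 2}\<close> is the number of eigenvalues of \<open>X\<close> in the
  field. The numbers of points with a given \<open>k\<close> follow from three equations: the total count,
  the number of points with a double eigenvalue, and the number of pairs (matrix, eigenvalue).
\<close>

section \<open>Determinant of a diagonal matrix plus blocks on the classes of an index map\<close>

lemma det_last_row_unit:
  fixes A :: "'r::comm_ring_1 mat"
  assumes A: "A \<in> carrier_mat (Suc n) (Suc n)"
    and row: "\<And>j. j < n \<Longrightarrow> A $$ (n, j) = 0"
  shows "det A = A $$ (n, n) * det (mat n n (\<lambda>(i, j). A $$ (i, j)))"
proof -
  have "det A = (\<Sum>j<Suc n. A $$ (n, j) * cofactor A n j)"
    using laplace_expansion_row[OF A, of n] by simp
  also have "\<dots> = A $$ (n, n) * cofactor A n n"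
    using row by simp
  also have "mat_delete A n n = mat n n (\<lambda>(i, j). A $$ (i, j))"
    using A by (intro eq_matI) (auto simp: mat_delete_def)
  hence "cofactor A n n = det (mat n n (\<lambda>(i, j). A $$ (i, j)))"
    by (simp add: cofactor_def)
  finally show ?thesis .
qed

text \<open>
  The weights \<open>w\<close> make the induction go through: subtracting row \<open>k\<close> from row \<open>n\<close> and then adding
  column \<open>n\<close> to column \<open>k\<close>, for \<open>k\<close> in the class of \<open>n\<close>, leaves a matrix of the same form in which
  \<open>w n\<close> has been added to \<open>w k\<close>.
\<close>

lemma det_diagonal_plus_class_constant:
  fixes a b :: "'c \<Rightarrow> 'r::comm_ring_1" and f :: "nat \<Rightarrow> 'c" and w :: "nat \<Rightarrow> 'r"
  shows "det (mat n n (\<lambda>(i, j). (if i = j then a (f i) else 0) +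
                                (if f i = f j then b (f i) * w j else 0))) =
    (\<Prod>c\<in>f ` {..<n}. a c ^ (card {i. i < n \<and> f i = c} - 1) *
       (a c + b c * (\<Sum>i | i < n \<and> f i = c. w i)))"
proof (induction n arbitrary: w)
  case 0
  show ?case by simp
next
  case (Suc n)
  define N where "N n w = mat n n (\<lambda>(i, j). (if i = j then a (f i) else 0) +
                                (if f i = f j then b (f i) * w j else 0))" for n and w :: "nat \<Rightarrow> 'r"
  define F where "F n w c = a c ^ (card {i. i < n \<and> f i = c} - 1) *
       (a c + b c * (\<Sum>i | i < n \<and> f i = c. w i))" for n w c
  have IH: "det (N n w) = (\<Prod>c\<in>f ` {..<n}. F n w c)" for w
    unfolding N_def F_def by (rule Suc.IH)
  have other: "F (Suc n) w c = F n w c" if "c \<noteq> f n" for c w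
  proof -
    have "{i. i < Suc n \<and> f i = c} = {i. i < n \<and> f i = c}"
      using that less_Suc_eq by auto
    thus ?thesis by (simp add: F_def)
  qed
  have ins: "{i. i < Suc n \<and> f i = f n} = insert n {i. i < n \<and> f i = f n}"
    by auto
  have N: "N m w \<in> carrier_mat m m" for m w by (simp add: N_def)
  have "det (N (Suc n) w) = (\<Prod>c\<in>f ` {..<Suc n}. F (Suc n) w c)"
  proof (cases "f n \<in> f ` {..<n}")
    \<comment> \<open>If \<open>n\<close> opens a new class, its row already vanishes off the
      diagonal. The class is a singleton, so the exponent in \<open>F\<close> is 0 and the corner
      entry is the whole new factor.\<close>
    case False
    hence empty: "{i. i < n \<and> f i = f n} = {}"
      by (metis (mono_tags, lifting) empty_Collect_eq imageI lessThan_iff)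
    have "det (N (Suc n) w) = N (Suc n) w $$ (n, n) * det (mat n n (\<lambda>(i, j). N (Suc n) w $$ (i, j)))"
      using False by (intro det_last_row_unit N) (auto simp: N_def image_iff)
    also have "mat n n (\<lambda>(i, j). N (Suc n) w $$ (i, j)) = N n w"
      by (intro eq_matI) (auto simp: N_def)
    also have "N (Suc n) w $$ (n, n) = F (Suc n) w (f n)"
      by (simp add: N_def F_def ins empty)
    also have "det (N n w) = (\<Prod>c\<in>f ` {..<n}. F (Suc n) w c)"
      unfolding IH using False by (intro prod.cong refl other[symmetric]) blast
    finally show ?thesis using False by (simp add: lessThan_Suc)
  next
    case True
    then obtain k where k: "k < n" "f k = f n" by auto
    define w' where "w' = w(k := w k + w n)"
    \<comment> \<open>Rows \<open>n\<close> and \<open>k\<close> have the same class part, so row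
      \<open>n\<close> of \<open>R\<close> is \<open>a (f n)\<close> at \<open>n\<close>,
      \<open>- a (f n)\<close> at \<open>k\<close> and 0 elsewhere; the column operation then clears
      the entry at \<open>k\<close>.\<close>
    define R where "R = addrow (-1) n k (N (Suc n) w)"
    define S where "S = addcol 1 k n R"
    have "det (N (Suc n) w) = det R"
      using k by (simp add: R_def det_addrow[OF _ _ N])
    also have "\<dots> = det S"
      using k N by (simp add: S_def R_def det_addcol[of _ "Suc n"])
    also have "\<dots> = S $$ (n, n) * det (mat n n (\<lambda>(i, j). S $$ (i, j)))"
      using k by (intro det_last_row_unit) (auto simp: S_def R_def N_def)
    also have "S $$ (n, n) = a (f n)"
      using k by (simp add: S_def R_def N_def)
    also have "mat n n (\<lambda>(i, j). S $$ (i, j)) = N n w'"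
      using k by (intro eq_matI) (auto simp: S_def R_def N_def w'_def algebra_simps)
    also have "a (f n) * det (N n w') = (\<Prod>c\<in>f ` {..<n}. F (Suc n) w c)"
    proof -
      have fin: "finite (f ` {..<n})" by simp
      let ?I = "{i. i < n \<and> f i = f n}"
      have I: "k \<in> ?I" "finite ?I" using k by auto
      \<comment> \<open>Nonemptiness keeps the exponent \<open>card ?I - 1\<close> untruncated, so
        the extra factor \<open>a (f n)\<close> raises it by exactly one.\<close>
      have "card ?I \<noteq> 0" using I by auto
      moreover have "sum w' ?I = sum w (insert n ?I)"
        using sum.remove[OF I(2,1), of w] sum.remove[OF I(2,1), of w'] I
        by (simp add: w'_def algebra_simps)
      ultimately have 1: "a (f n) * F n w' (f n) = F (Suc n) w (f n)"
        unfolding F_def ins using I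
        by (cases "card ?I") (simp_all add: mult.assoc)
      have 2: "F n w' c = F (Suc n) w c" if "c \<noteq> f n" for c
      proof -
        have "sum w' {i. i < n \<and> f i = c} = sum w {i. i < n \<and> f i = c}"
          using that k by (intro sum.cong) (auto simp: w'_def)
        thus ?thesis using other[OF that, of w] by (simp add: F_def)
      qed
      show ?thesis
        unfolding IH prod.remove[OF fin True] mult.assoc[symmetric] 1
        using 2 by (intro arg_cong2[of _ _ _ _ "(*)"] prod.cong) auto
    qed
    also have "f ` {..<n} = f ` {..<Suc n}" using True by (auto simp: lessThan_Suc)
    finally show ?thesis .
  qed
  thus ?case by (simp add: N_def F_def)
qed

section \<open>Spectra of disjoint unions of cliques\<close>

lemma vertex_list:
  assumes "finite (pverts \<G>)"
  shows "distinct (vertex_list \<G>)" "set (vertex_list \<G>) = pverts \<G>"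
proof -
  have "\<exists>vs. distinct vs \<and> set vs = pverts \<G>"
    using finite_distinct_list[OF assms] by blast
  from someI_ex[OF this]
  show "distinct (vertex_list \<G>)" "set (vertex_list \<G>) = pverts \<G>"
    by (simp_all add: vertex_list_def)
qed

text \<open>The parameter treats both matrices at once: \<open>s = -1\<close> is degree minus
  adjacency, \<open>s = 1\<close> degree plus adjacency. Splitting off a constant block
  \<open>- s\<close> on each class leaves a diagonal in the characteristic matrix, so the
  determinant above applies with unit weights and is a product of linear factors.\<close>

lemma eigenvalue_mset_clique_union:
  fixes f :: "nat \<Rightarrow> 'c" and s :: complex and n :: nat
  defines "m \<equiv> \<lambda>c. card {i. i < n \<and> f i = c}"
  shows "eigenvalue_mset (mat n n (\<lambda>(i, j). if i = j then of_nat (m (f i)) - 1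
                                       else if f i = f j then s else 0)) =
    (\<Sum>c\<in>f ` {..<n}. replicate_mset (m c - 1) (of_nat (m c) - 1 - s) +
                         {#of_nat (m c) - 1 - s + of_nat (m c) * s#})"
proof -
  let ?M = "mat n n (\<lambda>(i, j). if i = j then of_nat (m (f i)) - 1
                                  else if f i = f j then s else 0)"
  define a where "a c = [:- (of_nat (m c) - 1 - s), 1:]" for c
  have "char_poly_matrix ?M =
    mat n n (\<lambda>(i, j). (if i = j then a (f i) else 0) + (if f i = f j then [:-s:] * 1 else 0))"
    by (intro eq_matI) (auto simp: char_poly_matrix_def a_def)
  hence "char_poly ?M = (\<Prod>c\<in>f ` {..<n}. a c ^ (m c - 1) * (a c + [:-s:] * of_nat (m c)))"
    unfolding char_poly_def
    using det_diagonal_plus_class_constant[of n a f "\<lambda>_. [:-s:]" "\<lambda>_. 1"]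
    by (simp add: m_def)
  also have "\<dots> = (\<Prod>c\<in>f ` {..<n}. a c ^ (m c - 1) *
                    [:- (of_nat (m c) - 1 - s + of_nat (m c) * s), 1:])"
    by (intro prod.cong) (simp_all add: a_def of_nat_poly algebra_simps)
  also have "proots \<dots> = (\<Sum>c\<in>f ` {..<n}. proots (a c ^ (m c - 1) *
                    [:- (of_nat (m c) - 1 - s + of_nat (m c) * s), 1:]))"
    by (intro proots_prod) (simp add: a_def del: mult_pCons_right)
  also have "\<dots> = (\<Sum>c\<in>f ` {..<n}. replicate_mset (m c - 1) (of_nat (m c) - 1 - s) +
                         {#of_nat (m c) - 1 - s + of_nat (m c) * s#})"
  proof (intro sum.cong refl)
    fix c
    have "proots (a c ^ (m c - 1) * [:- (of_nat (m c) - 1 - s + of_nat (m c) * s), 1:]) =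
        proots (a c ^ (m c - 1)) + proots [:- (of_nat (m c) - 1 - s + of_nat (m c) * s), 1:]"
      by (intro proots_mult) (auto simp: a_def)
    thus "proots (a c ^ (m c - 1) * [:- (of_nat (m c) - 1 - s + of_nat (m c) * s), 1:]) =
        replicate_mset (m c - 1) (of_nat (m c) - 1 - s) +
          {#of_nat (m c) - 1 - s + of_nat (m c) * s#}"
      by (simp only: a_def proots_power proots_linear_factor repeat_mset_replicate_mset minus_minus)
  qed
  finally show ?thesis unfolding eigenvalue_mset_def .
qed

text \<open>A vertex in a clique of size \<open>m c\<close> has degree \<open>m c - 1\<close>, so
  after enumerating the vertices both matrices take the form of the previous lemma. Every
  \<open>c\<close> in the sums has a nonempty fibre, so \<open>m c - 1\<close> is not
  truncated.\<close>

lemma L_Q_Spec_clique_union: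
  fixes \<G> :: "'v pair_pre_digraph" and f :: "'v \<Rightarrow> 'c"
  assumes fin: "finite (pverts \<G>)"
    and arcs: "parcs \<G> = {(x, y). x \<in> pverts \<G> \<and> y \<in> pverts \<G> \<and> x \<noteq> y \<and> f x = f y}"
  defines "m \<equiv> \<lambda>c. card {x \<in> pverts \<G>. f x = c}"
  shows "L_Spec \<G> = (\<Sum>c\<in>f ` pverts \<G>. replicate_mset (m c - 1) (of_nat (m c)) + {#0#})"
    and "Q_Spec \<G> = (\<Sum>c\<in>f ` pverts \<G>. replicate_mset (m c - 1) (of_nat (m c) - 2) +
                        {#2 * of_nat (m c) - 2#})"
proof -
  define vs where "vs = vertex_list \<G>"
  define n where "n = length vs"
  define g where "g i = f (vs ! i)" for i
  note vs = vertex_list[OF fin, folded vs_def]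
  have bij: "bij_betw ((!) vs) {..<n} (pverts \<G>)"
    by (rule bij_betw_nth) (simp_all add: n_def vs)
  have m: "m c = card {i. i < n \<and> g i = c}" for c
  proof -
    have "bij_betw ((!) vs) {i. i < n \<and> g i = c} {x \<in> pverts \<G>. f x = c}"
      using bij unfolding bij_betw_def g_def by (auto simp: inj_on_def image_iff)
    from bij_betw_same_card[OF this] show ?thesis by (simp add: m_def)
  qed
  have img: "g ` {..<n} = f ` pverts \<G>"
    unfolding bij_betw_imp_surj_on[OF bij, symmetric] by (simp add: g_def image_image)
  have mem: "vs ! i \<in> pverts \<G>" if "i < n" for i
    using nth_mem[of i vs] that unfolding n_def vs(2) .
  have deg: "of_nat (out_degree (with_proj \<G>) (vs ! i)) = (of_nat (m (g i)) - 1 :: complex)"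
    if "i < n" for i
  proof -
    let ?x = "vs ! i" and ?C = "{x \<in> pverts \<G>. f x = g i}"
    have C: "finite ?C" "?x \<in> ?C" using fin mem[OF that] by (auto simp: g_def)
    have "out_arcs (with_proj \<G>) ?x = Pair ?x ` (?C - {?x})"
      using mem[OF that] by (auto simp: out_arcs_def arcs g_def)
    hence "out_degree (with_proj \<G>) ?x = card (?C - {?x})"
      by (simp add: out_degree_def card_image inj_on_def)
    hence "Suc (out_degree (with_proj \<G>) ?x) = m (g i)"
      unfolding m_def by (simp only: card.remove[OF C])
    thus ?thesis by (metis add_diff_cancel_left' of_nat_Suc)
  qed
  have adj: "(vs ! i, vs ! j) \<in> parcs \<G> \<longleftrightarrow> i \<noteq> j \<and> g i = g j" if "i < n" "j < n" for i j
    using that mem vs(1) by (auto simp: arcs g_def n_def nth_eq_iff_index_eq)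
  define M where "M s = mat n n (\<lambda>(i, j). if i = j then of_nat (m (g i)) - 1
                                      else if g i = g j then s else 0)" for s :: complex
  have M: "degree_matrix \<G> - adjacency_matrix \<G> = M (-1)"
    "degree_matrix \<G> + adjacency_matrix \<G> = M 1"
    unfolding degree_matrix_def adjacency_matrix_def Let_def vs_def[symmetric]
      n_def[symmetric] M_def
    by (intro eq_matI; simp add: deg adj)+
  have eig: "eigenvalue_mset (M s) =
    (\<Sum>c\<in>f ` pverts \<G>. replicate_mset (m c - 1) (of_nat (m c) - 1 - s) +
                         {#of_nat (m c) - 1 - s + of_nat (m c) * s#})" for s
    unfolding M_def m img[symmetric] by (rule eigenvalue_mset_clique_union)
  have "x - 1 - (- 1) = x" "x - 1 - (- 1) + x * (- 1) = 0"
    "x - 1 - 1 = x - 2" "x - 1 - 1 + x * 1 = 2 * x - 2" for x :: complex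
    by simp_all
  thus
    "L_Spec \<G> = (\<Sum>c\<in>f ` pverts \<G>. replicate_mset (m c - 1) (of_nat (m c)) + {#0#})"
    "Q_Spec \<G> = (\<Sum>c\<in>f ` pverts \<G>. replicate_mset (m c - 1) (of_nat (m c) - 2) +
                        {#2 * of_nat (m c) - 2#})"
    unfolding L_Spec_def Q_Spec_def M eig by (simp_all only:)
qed

section \<open>Groups in which commuting is transitive outside the centre\<close>

text \<open>The centralizer of \<open>x\<close> with the centre removed; it serves as the label of
  the clique of \<open>x\<close>.\<close>

definition commuting_class :: "('g, 'b) monoid_scheme \<Rightarrow> 'g \<Rightarrow> 'g set" where
  "commuting_class G x = {y \<in> carrier G - group_center G. x \<otimes>\<^bsub>G\<^esub> y = y \<otimes>\<^bsub>G\<^esub> x}"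

text \<open>For a group this says that centralizers of noncentral elements are abelian.\<close>

definition commutation_transitive :: "('g, 'b) monoid_scheme \<Rightarrow> bool" where
  "commutation_transitive G \<longleftrightarrow>
     (\<forall>x\<in>carrier G - group_center G. \<forall>y\<in>carrier G - group_center G. \<forall>z\<in>carrier G - group_center G.
        x \<otimes>\<^bsub>G\<^esub> y = y \<otimes>\<^bsub>G\<^esub> x \<longrightarrow> y \<otimes>\<^bsub>G\<^esub> z = z \<otimes>\<^bsub>G\<^esub> y \<longrightarrow> x \<otimes>\<^bsub>G\<^esub> z = z \<otimes>\<^bsub>G\<^esub> x)"

text \<open>Under transitivity, commuting is an equivalence relation on the noncentral elements, and
  \<open>commuting_class G x\<close> is the equivalence class of \<open>x\<close>.\<close>

lemma commuting_class_eq_iff: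
  assumes trans: "commutation_transitive G"
    and xy: "x \<in> carrier G - group_center G" "y \<in> carrier G - group_center G"
  shows "commuting_class G x = commuting_class G y \<longleftrightarrow> x \<otimes>\<^bsub>G\<^esub> y = y \<otimes>\<^bsub>G\<^esub> x"
proof
  assume "commuting_class G x = commuting_class G y"
  moreover have "x \<in> commuting_class G x" using xy by (simp add: commuting_class_def)
  ultimately have "x \<in> commuting_class G y" by simp
  thus "x \<otimes>\<^bsub>G\<^esub> y = y \<otimes>\<^bsub>G\<^esub> x" by (simp add: commuting_class_def)
next
  assume c: "x \<otimes>\<^bsub>G\<^esub> y = y \<otimes>\<^bsub>G\<^esub> x"
  show "commuting_class G x = commuting_class G y"
    unfolding commuting_class_def
  proof (intro Collect_cong conj_cong refl)
    fix z assume z: "z \<in> carrier G - group_center G"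
    show "x \<otimes>\<^bsub>G\<^esub> z = z \<otimes>\<^bsub>G\<^esub> x \<longleftrightarrow> y \<otimes>\<^bsub>G\<^esub> z = z \<otimes>\<^bsub>G\<^esub> y"
      using trans xy z c unfolding commutation_transitive_def by metis
  qed
qed

text \<open>Each label is, as a set, its own fibre; hence clique sizes are simply the cardinalities
  of the labels.\<close>

lemma commuting_class_fiber:
  assumes trans: "commutation_transitive G"
    and x: "x \<in> carrier G - group_center G"
  shows "{y \<in> carrier G - group_center G. commuting_class G y = commuting_class G x} =
    commuting_class G x"
proof -
  have "commuting_class G y = commuting_class G x \<longleftrightarrow> x \<otimes>\<^bsub>G\<^esub> y = y \<otimes>\<^bsub>G\<^esub> x"
    if "y \<in> carrier G - group_center G" for y
    using commuting_class_eq_iff[OF trans that x] by auto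
  thus ?thesis unfolding commuting_class_def[of G x] by blast
qed

lemma L_Q_Spec_commuting_graph:
  fixes G :: "('g, 'b) monoid_scheme"
  defines "V \<equiv> carrier G - group_center G"
  assumes fin: "finite (carrier G)"
    and trans: "commutation_transitive G"
  shows "L_Spec (commuting_graph G) = (\<Sum>c\<in>commuting_class G ` V.
      replicate_mset (card c - 1) (of_nat (card c)) + {#0#})"
    and "Q_Spec (commuting_graph G) = (\<Sum>c\<in>commuting_class G ` V.
      replicate_mset (card c - 1) (of_nat (card c) - 2) + {#2 * of_nat (card c) - 2#})"
proof -
  have V: "pverts (commuting_graph G) = V" by (simp add: commuting_graph_def V_def)
  have arcs: "parcs (commuting_graph G) =
    {(x, y). x \<in> pverts (commuting_graph G) \<and> y \<in> pverts (commuting_graph G) \<and> x \<noteq> y \<and>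
             commuting_class G x = commuting_class G y}"
    using commuting_class_eq_iff[OF trans] by (auto simp: commuting_graph_def)
  have finV: "finite (pverts (commuting_graph G))" using fin by (simp add: V V_def)
  have m: "{y \<in> V. commuting_class G y = c} = c" if "c \<in> commuting_class G ` V" for c
    using that commuting_class_fiber[OF trans] unfolding V_def by blast
  show "L_Spec (commuting_graph G) = (\<Sum>c\<in>commuting_class G ` V.
      replicate_mset (card c - 1) (of_nat (card c)) + {#0#})"
    unfolding L_Q_Spec_clique_union(1)[OF finV arcs] V by (intro sum.cong refl) (simp only: m)
  show "Q_Spec (commuting_graph G) = (\<Sum>c\<in>commuting_class G ` V.
      replicate_mset (card c - 1) (of_nat (card c) - 2) + {#2 * of_nat (card c) - 2#})"
    unfolding L_Q_Spec_clique_union(2)[OF finV arcs] V by (intro sum.cong refl) (simp only: m)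
qed

text \<open>The classes of size \<open>s\<close> partition the vertices lying in them. This later
  turns a count of matrices into a count of cliques.\<close>

lemma card_commuting_classes_of_card:
  fixes G :: "('g, 'b) monoid_scheme"
  defines "V \<equiv> carrier G - group_center G"
  assumes fin: "finite (carrier G)"
    and trans: "commutation_transitive G"
  shows "s * card {c \<in> commuting_class G ` V. card c = s} =
    card {x \<in> V. card (commuting_class G x) = s}"
proof -
  let ?P = "{c \<in> commuting_class G ` V. card c = s}"
  have fiber: "x \<in> c \<longleftrightarrow> x \<in> V \<and> commuting_class G x = c" if "c \<in> commuting_class G ` V" for c x
    using that commuting_class_fiber[OF trans] unfolding V_def by blast
  have U: "\<Union>?P = {x \<in> V. card (commuting_class G x) = s}"
  proof (rule Set.set_eqI, rule HOL.iffI)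
    fix x assume "x \<in> \<Union>?P"
    thus "x \<in> {x \<in> V. card (commuting_class G x) = s}" using fiber by auto
  next
    fix x assume "x \<in> {x \<in> V. card (commuting_class G x) = s}"
    moreover from this have "x \<in> commuting_class G x" using fiber by simp
    ultimately show "x \<in> \<Union>?P" by blast
  qed
  have finV: "finite V" using fin by (simp add: V_def)
  have "s * card ?P = card (\<Union>?P)"
  proof (rule card_partition)
    show "finite ?P" using finV by simp
    show "finite (\<Union>?P)" unfolding U using finV by simp
    show "c \<inter> c' = {}" if "c \<in> ?P" "c' \<in> ?P" "c \<noteq> c'" for c c'
      using that fiber[of c] fiber[of c'] by auto
  qed blast
  thus ?thesis by (simp only: U)
qed

section \<open>Coordinates on \<open>GL(2, q)\<close>: triples, scalar shifts and
  commutation\<close>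

lemma det_2x2:
  fixes A :: "'a::comm_ring_1 mat"
  assumes A: "A \<in> carrier_mat 2 2"
  shows "det A = A $$ (0, 0) * A $$ (1, 1) - A $$ (0, 1) * A $$ (1, 0)"
proof -
  have "cofactor A 0 0 = A $$ (1, 1)" "cofactor A 0 1 = - A $$ (1, 0)"
    using A by (simp_all add: cofactor_def det_single mat_delete_def)
  thus ?thesis
    using laplace_expansion_row[OF A, of 0] by (simp add: numeral_2_eq_2)
qed

lemma mult_mat_2x2:
  fixes A B :: "'a::comm_ring_1 mat"
  assumes "A \<in> carrier_mat 2 2" "B \<in> carrier_mat 2 2" "i < 2" "j < 2"
  shows "(A * B) $$ (i, j) = A $$ (i, 0) * B $$ (0, j) + A $$ (i, 1) * B $$ (1, j)"
  using assms by (simp add: scalar_prod_def numeral_2_eq_2)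

text \<open>
  The triple \<open>(t, b, c)\<close> encodes the matrix with rows \<open>(d + t, b)\<close> and \<open>(c, d)\<close> up to the scalar
  shift \<open>d\<close>. Its singular shifts are the negated eigenvalues of the representative with \<open>d = 0\<close>;
  working with \<open>x (x + t) = b c\<close> instead of a discriminant covers characteristic 2.
\<close>

definition mat_of_shift :: "('a \<times> 'a \<times> 'a) \<times> 'a \<Rightarrow> 'a::field mat" where
  "mat_of_shift = (\<lambda>((t, b, c), d). mat 2 2 (\<lambda>(i, j).
     if i = 0 then (if j = 0 then d + t else b) else (if j = 0 then c else d)))"

definition singular_shifts :: "'a \<times> 'a \<times> 'a \<Rightarrow> 'a::field set" where
  "singular_shifts = (\<lambda>(t, b, c). {x. x * (x + t) = b * c})"

lemma mat_of_shift_carrier [simp]: "mat_of_shift u \<in> carrier_mat 2 2"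
  by (simp add: mat_of_shift_def split: prod.split)

lemma mat_of_shift_index:
  "mat_of_shift ((t, b, c), d) $$ (0, 0) = d + t"
  "mat_of_shift ((t, b, c), d) $$ (0, Suc 0) = b"
  "mat_of_shift ((t, b, c), d) $$ (Suc 0, 0) = c"
  "mat_of_shift ((t, b, c), d) $$ (Suc 0, Suc 0) = d"
  by (simp_all add: mat_of_shift_def)

lemma eq_mat_2x2_iff:
  assumes "A \<in> carrier_mat 2 2" "B \<in> carrier_mat 2 2"
  shows "A = B \<longleftrightarrow> A $$ (0, 0) = B $$ (0, 0) \<and> A $$ (0, 1) = B $$ (0, 1) \<and>
                   A $$ (1, 0) = B $$ (1, 0) \<and> A $$ (1, 1) = B $$ (1, 1)"
proof
  assume eq: "A $$ (0, 0) = B $$ (0, 0) \<and> A $$ (0, 1) = B $$ (0, 1) \<and>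
            A $$ (1, 0) = B $$ (1, 0) \<and> A $$ (1, 1) = B $$ (1, 1)"
  show "A = B"
  proof (rule eq_matI)
    fix i j assume "i < dim_row B" "j < dim_col B"
    hence "(i = 0 \<or> i = 1) \<and> (j = 0 \<or> j = 1)" using assms by auto
    thus "A $$ (i, j) = B $$ (i, j)" using eq by auto
  qed (use assms in auto)
qed auto

lemma mat_of_shift_surj:
  fixes A :: "'a::field mat"
  assumes "A \<in> carrier_mat 2 2"
  obtains t b c d where "A = mat_of_shift ((t, b, c), d)"
proof
  show "A = mat_of_shift ((A $$ (0, 0) - A $$ (1, 1), A $$ (0, 1), A $$ (1, 0)), A $$ (1, 1))"
    using assms by (simp add: eq_mat_2x2_iff mat_of_shift_index)
qed

lemma inj_mat_of_shift: "inj mat_of_shift"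
  by (rule injI) (auto simp: eq_mat_2x2_iff mat_of_shift_index split_paired_all)

text \<open>The scalar parts \<open>d\<close> and \<open>d'\<close> drop out of the commutator; what
  remains are the 2x2 minors of the two triples, so the condition is linear dependence.\<close>

lemma mat_of_shift_commute_iff:
  "mat_of_shift ((t, b, c), d) * mat_of_shift ((t', b', c'), d') =
     mat_of_shift ((t', b', c'), d') * mat_of_shift ((t, b, c), d) \<longleftrightarrow>
   t * b' = t' * b \<and> t * c' = t' * c \<and> b * c' = b' * c"
  by (subst eq_mat_2x2_iff) (auto simp: mult_mat_2x2 mat_of_shift_index algebra_simps intro!: mult_carrier_mat[where n = 2])

text \<open>The determinant is \<open>(d + t) * d - b * c\<close>, which vanishes precisely for
  \<open>d\<close> in \<open>singular_shifts (t, b, c)\<close>.\<close>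

lemma carrier_GL2:
  "carrier (general_linear_group 2 TYPE('a::field)) =
     mat_of_shift ` {(v, d). d \<notin> singular_shifts v}"
proof -
  have "carrier (general_linear_group 2 TYPE('a)) = {A \<in> carrier_mat 2 2. det A \<noteq> 0}"
    using unit_imp_det_non_zero[of _ 2 "()"] det_non_zero_imp_unit[of _ 2, where b = "()"]
    by (auto simp: general_linear_group_def units_of_def Units_def ring_mat_def)
  also have "\<dots> = mat_of_shift ` {(v, d). d \<notin> singular_shifts v}"
  proof (intro equalityI subsetI)
    fix A :: "'a mat" assume A: "A \<in> {A \<in> carrier_mat 2 2. det A \<noteq> 0}"
    then obtain t b c d where eq: "A = mat_of_shift ((t, b, c), d)"
      using mat_of_shift_surj by blast
    with A show "A \<in> mat_of_shift ` {(v, d). d \<notin> singular_shifts v}"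
      by (auto simp: det_2x2 mat_of_shift_index singular_shifts_def algebra_simps)
  qed (auto simp: det_2x2 mat_of_shift_index singular_shifts_def algebra_simps)
  finally show ?thesis .
qed

lemma mult_GL [simp]: "mult (general_linear_group n ty) = (*)"
  by (simp add: general_linear_group_def units_of_def ring_mat_def)

lemma noncentral_GL2:
  defines "G \<equiv> general_linear_group 2 TYPE('a::field)"
  shows "carrier G - group_center G =
    mat_of_shift ` (SIGMA v:- {(0, 0, 0)}. - singular_shifts v)"
proof -
  \<comment> \<open>Two transvections suffice to test centrality: commuting with the first forces
    \<open>t = c = 0\<close>, with the second \<open>t = b = 0\<close>.\<close>
  have upper: "mat_of_shift ((0, 1, 0), 1) \<in> carrier G"
    and lower: "mat_of_shift ((0, 0, 1), 1) \<in> carrier G"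
    by (auto simp: G_def carrier_GL2 singular_shifts_def)
  have "mat_of_shift (v, d) \<in> group_center G \<longleftrightarrow> v = (0, 0, 0)"
    if "mat_of_shift (v, d) \<in> carrier G" for v d
  proof
    assume c: "mat_of_shift (v, d) \<in> group_center G"
    obtain t b c where v: "v = (t, b, c)" by (cases v)
    from c upper lower show "v = (0, 0, 0)"
      by (auto simp: group_center_def G_def v mat_of_shift_commute_iff)
  next
    assume "v = (0, 0, 0)"
    thus "mat_of_shift (v, d) \<in> group_center G"
      using that by (auto simp: group_center_def G_def carrier_GL2 mat_of_shift_commute_iff)
  qed
  thus ?thesis by (auto simp: G_def carrier_GL2)
qed

text \<open>The scalar is the ratio at a coordinate where the first triple is nonzero; the minors
  give the other coordinates, and the scalar is nonzero because the second triple is.\<close>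

lemma proportional_triple:
  fixes t b c :: "'a::field"
  assumes "(t, b, c) \<noteq> (0, 0, 0)" "(t', b', c') \<noteq> (0, 0, 0)"
    and "t * b' = t' * b" "t * c' = t' * c" "b * c' = b' * c"
  obtains r where "r \<noteq> 0" "t' = r * t" "b' = r * b" "c' = r * c"
proof -
  consider "t \<noteq> 0" | "t = 0" "b \<noteq> 0" | "t = 0" "b = 0" "c \<noteq> 0" using assms(1) by auto
  thus ?thesis
  proof cases
    case 1
    with assms show ?thesis by (intro that[of "t' / t"]) (auto simp: field_simps)
  next
    case 2
    with assms show ?thesis by (intro that[of "b' / b"]) (auto simp: field_simps)
  next
    case 3
    with assms show ?thesis by (intro that[of "c' / c"]) (auto simp: field_simps)
  qed
qed

text \<open>The middle triple is \<open>r\<close> times the first with \<open>r\<close> nonzero;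
  substituting this into its minors with the third triple and cancelling \<open>r\<close> leaves the
  minors of the first and third.\<close>

lemma commutation_transitive_GL2:
  "commutation_transitive (general_linear_group 2 TYPE('a::field))"
  unfolding commutation_transitive_def noncentral_GL2
proof (intro ballI impI)
  fix X Y Z :: "'a mat"
  let ?V = "mat_of_shift ` (SIGMA v:- {(0, 0, 0)}. - singular_shifts v)"
  have shift: "\<exists>v d. A = mat_of_shift (v, d) \<and> v \<noteq> (0, 0, 0)" if "A \<in> ?V" for A
    using that by blast
  assume "X \<in> ?V" "Y \<in> ?V" "Z \<in> ?V"
  from this[THEN shift] obtain x y z d e f where
    X: "X = mat_of_shift (x, d)" "x \<noteq> (0, 0, 0)" and
    Y: "Y = mat_of_shift (y, e)" "y \<noteq> (0, 0, 0)" and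
    Z: "Z = mat_of_shift (z, f)" "z \<noteq> (0, 0, 0)"
    by blast
  obtain t1 b1 c1 where x: "x = (t1, b1, c1)" by (cases x)
  obtain t2 b2 c2 where y: "y = (t2, b2, c2)" by (cases y)
  obtain t3 b3 c3 where z: "z = (t3, b3, c3)" by (cases z)
  assume "X \<otimes>\<^bsub>general_linear_group 2 TYPE('a)\<^esub> Y = Y \<otimes>\<^bsub>general_linear_group 2 TYPE('a)\<^esub> X"
    and "Y \<otimes>\<^bsub>general_linear_group 2 TYPE('a)\<^esub> Z = Z \<otimes>\<^bsub>general_linear_group 2 TYPE('a)\<^esub> Y"
  hence "t1 * b2 = t2 * b1 \<and> t1 * c2 = t2 * c1 \<and> b1 * c2 = b2 * c1"
    and yz: "t2 * b3 = t3 * b2 \<and> t2 * c3 = t3 * c2 \<and> b2 * c3 = b3 * c2"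
    by (simp_all add: X Y Z x y z mat_of_shift_commute_iff)
  then obtain r where "r \<noteq> 0" "t2 = r * t1" "b2 = r * b1" "c2 = r * c1"
    using proportional_triple X Y x y by metis
  with yz have "t1 * b3 = t3 * b1 \<and> t1 * c3 = t3 * c1 \<and> b1 * c3 = b3 * c1"
    by (auto simp: mult_ac)
  thus "X \<otimes>\<^bsub>general_linear_group 2 TYPE('a)\<^esub> Z = Z \<otimes>\<^bsub>general_linear_group 2 TYPE('a)\<^esub> X"
    by (simp add: X Z x z mat_of_shift_commute_iff)
qed

text \<open>By proportionality, each member of the class is uniquely \<open>r\<close> times a matrix
  with triple \<open>(t, b, c)\<close> and shift \<open>e\<close>, where \<open>r\<close> is nonzero
  and \<open>e\<close> not singular; the pairs \<open>(r, e)\<close> are counted.\<close>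

lemma card_commuting_class_GL2:
  fixes t b c :: "'a::{field,finite}"
  assumes v: "(t, b, c) \<noteq> (0, 0, 0)"
  shows "card (commuting_class (general_linear_group 2 TYPE('a)) (mat_of_shift ((t, b, c), d))) =
    (CARD('a) - 1) * (CARD('a) - card (singular_shifts (t, b, c)))"
proof -
  let ?S = "singular_shifts (t, b, c)"
  \<comment> \<open>Scaling a triple by \<open>r\<close> scales its singular shifts by
    \<open>r\<close>, so writing the shift as \<open>r * e\<close> makes the excluded set
    independent of \<open>r\<close>.\<close>
  let ?h = "\<lambda>(r, e). ((r * t, r * b, r * c), r * e)"
  have "commuting_class (general_linear_group 2 TYPE('a)) (mat_of_shift ((t, b, c), d)) =
    mat_of_shift ` ?h ` ((- {0}) \<times> (- ?S))" (is "?C = ?R")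
  proof (intro equalityI subsetI)
    fix Y assume "Y \<in> ?C"
    hence comm: "mat_of_shift ((t, b, c), d) * Y = Y * mat_of_shift ((t, b, c), d)"
      and "Y \<in> mat_of_shift ` (SIGMA v:- {(0, 0, 0)}. - singular_shifts v)"
      by (simp_all add: commuting_class_def noncentral_GL2)
    then obtain v' d' where Y': "Y = mat_of_shift (v', d')" "v' \<noteq> (0, 0, 0)" "d' \<notin> singular_shifts v'"
      by blast
    obtain t' b' c' where v'_eq: "v' = (t', b', c')" by (cases v')
    have Y: "Y = mat_of_shift ((t', b', c'), d')" and v': "(t', b', c') \<noteq> (0, 0, 0)"
      and d': "d' \<notin> singular_shifts (t', b', c')"
      using Y' unfolding v'_eq by blast+
    from comm have "t * b' = t' * b" "t * c' = t' * c" "b * c' = b' * c"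
      by (simp_all add: Y mat_of_shift_commute_iff)
    with v v' obtain r where r: "r \<noteq> 0" "t' = r * t" "b' = r * b" "c' = r * c"
      using proportional_triple by metis
    have "d' / r \<notin> ?S"
      using d' r by (auto simp: singular_shifts_def field_simps)
    moreover have "((t', b', c'), d') = ?h (r, d' / r)" using r by simp
    ultimately have "((t', b', c'), d') \<in> ?h ` ((- {0}) \<times> (- ?S))"
      using r(1) by (intro image_eqI[of _ _ "(r, d' / r)"]) auto
    thus "Y \<in> ?R" unfolding Y by (rule imageI)
  next
    fix Y assume "Y \<in> ?R"
    then obtain r e where r: "r \<noteq> 0" and e: "e \<notin> ?S"
      and Y: "Y = mat_of_shift ((r * t, r * b, r * c), r * e)"
      by auto
    have "(r * e) * (r * e + r * t) = r * r * (e * (e + t))" by (simp add: algebra_simps)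
    moreover have "(r * b) * (r * c) = r * r * (b * c)" by (simp add: algebra_simps)
    moreover have "r * r * (e * (e + t)) \<noteq> r * r * (b * c)"
      using e r by (simp add: singular_shifts_def)
    ultimately have "r * e \<notin> singular_shifts (r * t, r * b, r * c)"
      by (simp only: singular_shifts_def prod.case mem_Collect_eq not_False_eq_True)
    thus "Y \<in> ?C"
      using v r unfolding commuting_class_def noncentral_GL2 Y
      by (auto simp: mat_of_shift_commute_iff)
  qed
  moreover have "inj_on ?h ((- {0}) \<times> (- ?S))"
    using v by (auto simp: inj_on_def)
  ultimately have "card ?C = card ((- {0::'a}) \<times> (- ?S))"
    by (simp add: card_image inj_on_subset[OF inj_mat_of_shift])
  thus ?thesis by (simp add: card_cartesian_product Compl_eq_Diff_UNIV card_Diff_subset)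
qed

section \<open>Counting triples by their number of singular shifts\<close>

text \<open>Vieta: the two roots of the quadratic sum to \<open>- t\<close>. They may coincide.
  Factoring the difference of two values needs no division by 2.\<close>

lemma singular_shifts_eq_pair:
  fixes x :: "'a::field"
  assumes "x \<in> singular_shifts (t, b, c)"
  shows "singular_shifts (t, b, c) = {x, - t - x}"
proof -
  have "y * (y + t) = x * (x + t) \<longleftrightarrow> (y - x) * (y - (- t - x)) = 0" for y
    by (simp add: algebra_simps)
  hence "y * (y + t) = x * (x + t) \<longleftrightarrow> y = x \<or> y = - t - x" for y
    by (simp only: mult_eq_0_iff right_minus_eq)
  thus ?thesis using assms by (auto simp: singular_shifts_def)
qed

lemma card_singular_shifts_le_2: "card (singular_shifts (v :: 'a::field \<times> 'a \<times> 'a)) \<le> 2"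
proof (cases v)
  case (fields t b c)
  show ?thesis
  proof (cases "singular_shifts v = {}")
    case False
    then obtain x where "x \<in> singular_shifts v" by blast
    with fields have "singular_shifts v = {x, - t - x}"
      using singular_shifts_eq_pair by blast
    thus ?thesis by (simp add: card_insert_if)
  qed simp
qed

text \<open>Substituting \<open>t = - 2 x\<close>, these are the triples \<open>(t, b, c)\<close> with a double singular shift \<open>x\<close>.\<close>

lemma card_isotropic_triples:
  "card {(x, b, c). - (x * x) = b * (c :: 'a::{field,finite})} = CARD('a) ^ 2"
proof -
  \<comment> \<open>For \<open>b\<close> nonzero, \<open>c\<close> is determined by
    \<open>(x, b)\<close>. For \<open>b = 0\<close>, \<open>x\<close> must be 0 and \<open>c\<close>
    is free, which fills the remaining pairs with second coordinate 0.\<close>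
  have "bij_betw (\<lambda>(x, b, c). if b = 0 then (c, 0) else (x, b))
    {(x, b, c). - (x * x) = b * (c :: 'a)} (UNIV \<times> UNIV)"
    by (rule bij_betw_byWitness
          [where f' = "\<lambda>(u, b). if b = 0 then (0, 0, u) else (u, b, - (u * u) / b)"])
       (auto simp: field_simps split: if_splits)
  from bij_betw_same_card[OF this] show ?thesis
    by (simp add: card_cartesian_product power2_eq_square)
qed

lemma double_root_mem_singular_shifts_iff:
  "x \<in> singular_shifts (- x - x, b, c) \<longleftrightarrow> - (x * x) = b * (c :: 'a::field)"
proof -
  have "x + (- x - x) = - x" by simp
  thus ?thesis unfolding singular_shifts_def prod.case mem_Collect_eq by simp
qed

text \<open>A single shift \<open>x\<close> means that the other root \<open>- t - x\<close> equals
  \<open>x\<close>, so \<open>t = - x - x\<close>. This puts such triples in bijection with the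
  isotropic ones just counted.\<close>

lemma card_singular_shifts_eq_1:
  "card {v :: 'a::{field,finite} \<times> 'a \<times> 'a. card (singular_shifts v) = 1} = CARD('a) ^ 2"
proof -
  \<comment> \<open>In characteristic 2 the equation for \<open>t\<close> reads
    \<open>0 = 0\<close>; uniqueness comes instead from both \<open>x\<close> and \<open>y\<close>
    being roots of a quadratic whose two roots coincide.\<close>
  have root_unique: "x = y"
    if "- (x * x) = b * c" "- (y * y) = b * c" and t: "- x - x = - y - y" for x y b c :: 'a
  proof -
    have x: "x \<in> singular_shifts (- x - x, b, c)" and "y \<in> singular_shifts (- y - y, b, c)"
      using that double_root_mem_singular_shifts_iff by blast+
    hence y: "y \<in> singular_shifts (- x - x, b, c)" by (simp only: t)
    from y singular_shifts_eq_pair[OF x] show ?thesis by simp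
  qed
  have inj: "inj_on (\<lambda>(x, b, c). (- x - x, b, c)) {(x, b, c). - (x * x) = b * (c :: 'a)}"
    by (rule inj_onI) (clarsimp, rule root_unique, auto)
  have image: "(\<lambda>(x, b, c). (- x - x, b, c)) ` {(x, b, c). - (x * x) = b * (c :: 'a)} =
    {v. card (singular_shifts v) = 1}"
  proof (intro equalityI subsetI)
    fix v :: "'a \<times> 'a \<times> 'a" assume "v \<in> {v. card (singular_shifts v) = 1}"
    moreover obtain t b c where v: "v = (t, b, c)" by (cases v)
    ultimately obtain x where x: "singular_shifts (t, b, c) = {x}"
      by (auto simp: card_1_singleton_iff)
    hence mem: "x \<in> singular_shifts (t, b, c)" by simp
    from singular_shifts_eq_pair[OF mem] x have x': "- t - x = x" by auto
    have "t = - (- t - x) - x" by simp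
    hence t: "t = - x - x" unfolding x' .
    have "- (x * x) = b * c" using mem by (simp only: t double_root_mem_singular_shifts_iff)
    thus "v \<in> (\<lambda>(x, b, c). (- x - x, b, c)) ` {(x, b, c). - (x * x) = b * (c :: 'a)}"
      unfolding v t by (intro image_eqI[of _ _ "(x, b, c)"]) auto
  next
    fix v :: "'a \<times> 'a \<times> 'a"
    assume "v \<in> (\<lambda>(x, b, c). (- x - x, b, c)) ` {(x, b, c). - (x * x) = b * (c :: 'a)}"
    then obtain x b c where v: "v = (- x - x, b, c)" and "- (x * x) = b * c" by auto
    hence "x \<in> singular_shifts v" by (simp only: v double_root_mem_singular_shifts_iff)
    hence "singular_shifts v = {x}" unfolding v by (subst singular_shifts_eq_pair) auto
    thus "v \<in> {v. card (singular_shifts v) = 1}" by simp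
  qed
  show ?thesis using card_image[OF inj] unfolding image card_isotropic_triples .
qed

text \<open>Double counting of pairs (triple, singular shift). If \<open>b\<close> is nonzero,
  \<open>c\<close> is determined by \<open>b\<close>, \<open>t\<close>, \<open>x\<close>; if
  \<open>b = 0\<close>, then \<open>x * (x + t) = 0\<close> and \<open>c\<close> is free. With
  \<open>q = CARD('a)\<close> this gives \<open>(q - 1) * q^2 + (2 * q - 1) * q\<close>
  pairs.\<close>

lemma sum_card_singular_shifts:
  "(\<Sum>v\<in>UNIV. card (singular_shifts (v :: 'a::{field,finite} \<times> 'a \<times> 'a))) + CARD('a) =
     CARD('a) ^ 3 + CARD('a) ^ 2"
proof -
  let ?q = "CARD('a)"
  let ?Z = "SIGMA v:UNIV. singular_shifts (v :: 'a \<times> 'a \<times> 'a)"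
  let ?f = "\<lambda>(b :: 'a, t :: 'a, x :: 'a). ((t, b, x * (x + t) / b), x)" and ?g = "\<lambda>((t :: 'a, x :: 'a), c :: 'a). ((t, 0 :: 'a, c), x)"
  let ?A = "(- {0 :: 'a}) \<times> (UNIV :: 'a set) \<times> (UNIV :: 'a set)"
  \<comment> \<open>The pairs \<open>(t, x)\<close> with \<open>x = 0\<close> or
    \<open>x = - t\<close>; leaving out \<open>t = 0\<close> in the second part avoids counting
    \<open>(0, 0)\<close> twice.\<close>
  let ?D = "range (\<lambda>t :: 'a. (t, 0)) \<union> (\<lambda>t :: 'a. (t, - t)) ` (- {0})"
  let ?B = "?D \<times> (UNIV :: 'a set)"
  have "?Z = ?f ` ?A \<union> ?g ` ?B"
  proof (intro equalityI subsetI)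
    fix z assume "z \<in> ?Z"
    then obtain t b c x where z: "z = ((t, b, c), x)" and x: "x * (x + t) = b * c"
      by (auto simp: singular_shifts_def)
    show "z \<in> ?f ` ?A \<union> ?g ` ?B"
    proof (cases "b = 0")
      case False
      hence "?f (b, t, x) \<in> ?f ` ?A" by (intro imageI) simp
      moreover have "z = ?f (b, t, x)" using False x by (simp add: z)
      ultimately show ?thesis by blast
    next
      case True
      hence "x = 0 \<or> t = - x" using x by (simp add: eq_neg_iff_add_eq_0 add.commute)
      hence "(t, x) \<in> ?D" by auto
      hence "?g ((t, x), c) \<in> ?g ` ?B" by (intro imageI) simp
      moreover have "z = ?g ((t, x), c)" using True by (simp add: z)
      ultimately show ?thesis by blast
    qed
  qed (auto simp: singular_shifts_def)
  moreover have "?f ` ?A \<inter> ?g ` ?B = {}" by auto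
  ultimately have "card ?Z = card (?f ` ?A) + card (?g ` ?B)"
    by (simp add: card_Un_disjoint)
  also have "card (?f ` ?A) = (?q - 1) * (?q * ?q)"
    by (subst card_image) (auto simp: inj_on_def card_cartesian_product Compl_eq_Diff_UNIV card_Diff_subset)
  also have "card (?g ` ?B) = (?q + (?q - 1)) * ?q"
  proof -
    have "card ?D = ?q + (?q - 1)"
      by (subst card_Un_disjoint) (auto simp: card_image inj_on_def Compl_eq_Diff_UNIV card_Diff_subset)
    thus ?thesis by (subst card_image) (auto simp: inj_on_def card_cartesian_product)
  qed
  finally have "card ?Z = (?q - 1) * (?q * ?q) + (?q + (?q - 1)) * ?q" .
  moreover have "card ?Z = (\<Sum>v\<in>UNIV. card (singular_shifts (v :: 'a \<times> 'a \<times> 'a)))"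
    by (simp)
  moreover obtain m where "?q = Suc m" using zero_less_card_finite[where 'a = 'a] not0_implies_Suc by blast
  ultimately show ?thesis by (simp add: power3_eq_cube power2_eq_square algebra_simps)
qed

text \<open>The total count, the pair count and the double-root count form a linear system for the
  numbers of triples with 0, 1 and 2 singular shifts. The zero triple has the single shift 0, so
  removing it affects only \<open>M 1\<close>.\<close>

lemma card_nonzero_triples_by_singular_shifts:
  fixes M :: "nat \<Rightarrow> nat"
  defines "M k \<equiv> card {v :: 'a::{field,finite} \<times> 'a \<times> 'a. v \<noteq> (0, 0, 0) \<and> card (singular_shifts v) = k}"
  shows "2 * M 0 = CARD('a) * (CARD('a) - 1) * (CARD('a) - 1)"
    and "M 1 = (CARD('a) - 1) * (CARD('a) + 1)"
    and "2 * M 2 = CARD('a) * (CARD('a) + 1) * (CARD('a) - 1)"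
proof -
  let ?q = "CARD('a)"
  define N where "N k = {v :: 'a \<times> 'a \<times> 'a. card (singular_shifts v) = k}" for k
  have zero: "singular_shifts (0, 0, 0) = {0 :: 'a}" by (auto simp: singular_shifts_def)
  have M: "M k = card (N k - {(0, 0, 0)})" for k
    unfolding M_def N_def by (rule arg_cong[of _ _ card]) auto
  have M0: "M 0 = card (N 0)" and M2: "M 2 = card (N 2)"
    unfolding M by (simp_all add: N_def zero)
  have N1: "card (N 1) = ?q ^ 2" unfolding N_def by (rule card_singular_shifts_eq_1)
  hence M1: "M 1 = ?q ^ 2 - 1" unfolding M by (simp add: N_def zero)
  \<comment> \<open>With a free weight \<open>h\<close>, one grouping yields two equations: weight 1
    gives the total count, weight \<open>k\<close> the pair count.\<close>
  have "(\<Sum>v\<in>UNIV. h (card (singular_shifts (v :: 'a \<times> 'a \<times> 'a)))) = card (N 0) * h 0 + card (N 1) * h 1 + card (N 2) * h 2"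
    for h :: "nat \<Rightarrow> nat"
  proof -
    have "card (singular_shifts v) \<in> {0, 1, 2}" for v :: "'a \<times> 'a \<times> 'a"
      using card_singular_shifts_le_2[of v] unfolding insert_iff empty_iff by linarith
    hence "(\<lambda>v :: 'a \<times> 'a \<times> 'a. card (singular_shifts v)) ` UNIV \<subseteq> {0, 1, 2}" by (intro image_subsetI)
    from sum.group[OF _ _ this, of "\<lambda>v. h (card (singular_shifts v))"]
    have "(\<Sum>v\<in>UNIV. h (card (singular_shifts (v :: 'a \<times> 'a \<times> 'a)))) =
        (\<Sum>k\<in>{0, 1, 2}. \<Sum>v\<in>N k. h (card (singular_shifts v)))"
      by (simp add: N_def)
    also have "\<dots> = (\<Sum>k\<in>{0, 1, 2}. card (N k) * h k)"
      by (intro sum.cong refl) (simp add: N_def)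
    finally show ?thesis by simp
  qed
  from this[of "\<lambda>_. 1"] this[of "\<lambda>k. k"]
  have 0: "?q ^ 3 = card (N 0) + card (N 1) + card (N 2)"
    and 1: "?q ^ 3 + ?q ^ 2 = card (N 1) + 2 * card (N 2) + ?q"
    using sum_card_singular_shifts[where 'a = 'a]
    by (simp_all add: card_prod power3_eq_cube)
  obtain m where m: "?q = Suc m"
    using zero_less_card_finite[where 'a = 'a] not0_implies_Suc by blast
  show "2 * M 0 = ?q * (?q - 1) * (?q - 1)" "M 1 = (?q - 1) * (?q + 1)"
    "2 * M 2 = ?q * (?q + 1) * (?q - 1)"
    using 0 1 N1 M0 M1 M2 unfolding m
    by (simp_all add: power3_eq_cube power2_eq_square algebra_simps)
qed

section \<open>Numbers of cliques of each size and the resulting spectra\<close>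

lemma sum_constant_mset: "finite A \<Longrightarrow> (\<Sum>x\<in>A. M) = repeat_mset (card A) M"
  by (induction A rule: finite_induct) simp_all

lemma repeat_mset_replicate: "repeat_mset k (replicate_mset m x) = replicate_mset (k * m) x"
  by (rule multiset_eqI) simp

lemma replicate_mset_add: "replicate_mset (k + m) x = replicate_mset k x + replicate_mset m x"
  by (rule multiset_eqI) simp

lemma finite_GL2: "finite (carrier (general_linear_group 2 TYPE('a::{field,finite})))"
  unfolding carrier_GL2 by simp

text \<open>At most 2 shifts are singular and the field has more than 2 elements, so the class size
  determines the number of singular shifts. Each triple with \<open>k\<close> of them carries
  \<open>CARD('a) - k\<close> invertible matrices.\<close>

lemma card_noncentral_GL2_by_class:
  fixes k :: nat
  defines "G \<equiv> general_linear_group 2 TYPE('a::{field,finite})"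
  assumes q: "CARD('a) > 2" and k: "k \<le> 2"
  shows "card {X \<in> carrier G - group_center G.
      card (commuting_class G X) = (CARD('a) - 1) * (CARD('a) - k)} =
    card {v :: 'a \<times> 'a \<times> 'a. v \<noteq> (0, 0, 0) \<and> card (singular_shifts v) = k} * (CARD('a) - k)"
proof -
  let ?q = "CARD('a)"
  let ?A = "{v :: 'a \<times> 'a \<times> 'a. v \<noteq> (0, 0, 0) \<and> card (singular_shifts v) = k}"
  have card_eq: "card (commuting_class G (mat_of_shift (v, d))) = (?q - 1) * (?q - k) \<longleftrightarrow>
      card (singular_shifts v) = k" if "v \<noteq> (0, 0, 0)" for v d
  proof -
    obtain t b c where v: "v = (t, b, c)" by (cases v)
    have "card (commuting_class G (mat_of_shift (v, d))) =
        (?q - 1) * (?q - card (singular_shifts v))"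
      using card_commuting_class_GL2 that unfolding v G_def by blast
    moreover have "?q - card (singular_shifts v) = ?q - k \<longleftrightarrow> card (singular_shifts v) = k"
      using q k card_singular_shifts_le_2[of v] by linarith
    ultimately show ?thesis using q by simp
  qed
  have "{X \<in> carrier G - group_center G. card (commuting_class G X) = (?q - 1) * (?q - k)} =
      mat_of_shift ` (SIGMA v:?A. - singular_shifts v)"
    unfolding G_def noncentral_GL2 using card_eq unfolding G_def by blast
  also have "card \<dots> = card (SIGMA v:?A. - singular_shifts v)"
    by (intro card_image inj_on_subset[OF inj_mat_of_shift]) simp
  also have "\<dots> = (\<Sum>v\<in>?A. card (- singular_shifts v))"
    by (intro card_SigmaI) simp_all
  also have "\<dots> = (\<Sum>v\<in>?A. ?q - k)"
    by (intro sum.cong refl) (simp add: Compl_eq_Diff_UNIV card_Diff_subset)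
  finally show ?thesis by simp
qed

text \<open>Classes are grouped by the number \<open>k\<close> of singular shifts; the terms appear
  in the order \<open>k = 2, 1, 0\<close>. Leaving \<open>h\<close> arbitrary lets one count serve
  both spectra.\<close>

lemma sum_commuting_classes_GL2:
  fixes h :: "nat \<Rightarrow> 'm multiset"
  defines "G \<equiv> general_linear_group 2 TYPE('a::{field,finite})"
    and "q \<equiv> CARD('a)"
  assumes q: "q > 2"
  shows "(\<Sum>c\<in>commuting_class G ` (carrier G - group_center G). h (card c)) =
      repeat_mset (q * (q + 1) div 2) (h ((q - 1) * (q - 2))) +
      repeat_mset (q + 1) (h ((q - 1) * (q - 1))) +
      repeat_mset (q * (q - 1) div 2) (h ((q - 1) * q))"
proof -
  define P where "P = commuting_class G ` (carrier G - group_center G)"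
  define s where "s k = (q - 1) * (q - k)" for k
  define N where "N k = {c \<in> P. card c = s k}" for k
  have finP: "finite P" using finite_GL2[where 'a = 'a] by (simp add: P_def G_def)
  \<comment> \<open>Counting the vertices by classes and by triples and cancelling
    \<open>q - k\<close> reflects that each projective point has \<open>q - 1\<close> nonzero
    representatives.\<close>
  have N: "(q - 1) * card (N k) =
      card {v :: 'a \<times> 'a \<times> 'a. v \<noteq> (0, 0, 0) \<and> card (singular_shifts v) = k}"
    (is "_ = card ?A") if k: "k \<le> 2" for k
  proof -
    have "s k * card (N k) = card ?A * (q - k)"
      unfolding N_def P_def s_def q_def G_def
      by (rule trans[OF card_commuting_classes_of_card[OF finite_GL2 commutation_transitive_GL2]
            card_noncentral_GL2_by_class[OF q[unfolded q_def] k]])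
    hence "(q - k) * ((q - 1) * card (N k)) = (q - k) * card ?A"
      by (simp add: s_def mult_ac)
    thus ?thesis using q k by simp
  qed
  note M = card_nonzero_triples_by_singular_shifts[where 'a = 'a, folded q_def]
  have "2 * ((q - 1) * card (N 0)) = q * (q - 1) * (q - 1)"
    "(q - 1) * card (N 1) = (q - 1) * (q + 1)"
    "2 * ((q - 1) * card (N 2)) = q * (q + 1) * (q - 1)"
    by (simp_all only: N M le0 one_le_numeral order_refl)
  hence "(q - 1) * (2 * card (N 0)) = (q - 1) * (q * (q - 1))"
    "(q - 1) * card (N 1) = (q - 1) * (q + 1)"
    "(q - 1) * (2 * card (N 2)) = (q - 1) * (q * (q + 1))"
    by (simp_all only: mult_ac)
  hence "2 * card (N 0) = q * (q - 1)" and N1: "card (N 1) = q + 1"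
    and "2 * card (N 2) = q * (q + 1)"
    using q by (simp_all only: mult_cancel1) simp_all
  hence N0: "card (N 0) = q * (q - 1) div 2" and N2: "card (N 2) = q * (q + 1) div 2"
    by linarith+
  have size: "card c \<in> s ` {0, 1, 2}" if "c \<in> P" for c
  proof -
    from that obtain v d where v: "v \<noteq> (0, 0, 0)"
      and c: "c = commuting_class G (mat_of_shift (v, d :: 'a))"
      unfolding P_def G_def noncentral_GL2 by blast
    obtain t b u where tbu: "v = (t, b, u)" by (cases v)
    have "card c = s (card (singular_shifts v))"
      using v card_commuting_class_GL2 unfolding c tbu s_def G_def q_def by blast
    moreover have "card (singular_shifts v) \<in> {0, 1, 2}"
      using card_singular_shifts_le_2[of v] unfolding insert_iff empty_iff by linarith
    ultimately show ?thesis by (simp only: imageI)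
  qed
  \<comment> \<open>The three sizes are distinct, so grouping by size is grouping by
    \<open>k\<close>.\<close>
  have inj: "inj_on s {0, 1, 2}"
    using q by (auto simp: inj_on_def s_def)
  have "(\<Sum>c\<in>P. h (card c)) = (\<Sum>y\<in>s ` {0, 1, 2}. \<Sum>c | c \<in> P \<and> card c = y. h (card c))"
    using finP size by (intro sum.group[symmetric]) auto
  also have "\<dots> = (\<Sum>k\<in>{0, 1, 2}. \<Sum>c\<in>N k. h (card c))"
    by (subst sum.reindex[OF inj]) (simp add: N_def)
  also have "\<dots> = (\<Sum>k\<in>{0, 1, 2}. repeat_mset (card (N k)) (h (s k)))"
  proof (intro sum.cong refl)
    fix k
    have "(\<Sum>c\<in>N k. h (card c)) = (\<Sum>c\<in>N k. h (s k))"
      by (intro sum.cong refl) (simp add: N_def)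
    also have "finite (N k)" using finP by (simp add: N_def)
    hence "(\<Sum>c\<in>N k. h (s k)) = repeat_mset (card (N k)) (h (s k))"
      by (rule sum_constant_mset)
    finally show "(\<Sum>c\<in>N k. h (card c)) = repeat_mset (card (N k)) (h (s k))" .
  qed
  also have "\<dots> = repeat_mset (card (N 0)) (h (s 0)) + repeat_mset (card (N 1)) (h (s 1)) +
      repeat_mset (card (N 2)) (h (s 2))"
    by (simp add: add.assoc)
  finally show ?thesis
    unfolding N0 N1 N2 P_def by (simp add: s_def add_ac)
qed

theorem proposition2p12:
  fixes p n q :: nat
  assumes "prime p"
    and "q = p ^ n"
    and "q > 2"
    and "CARD('a::{field,finite}) = q"
  shows "L_Spec (commuting_graph (general_linear_group 2 TYPE('a))) =
           replicate_mset (q^2 + q + 1) 0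
         + replicate_mset (q * (q + 1) * (q^2 - 3 * q + 1) div 2)
             ((of_nat q)^2 - 3 * of_nat q + 2)
         + replicate_mset (q * (q - 1) * (q^2 - q - 1) div 2)
             ((of_nat q)^2 - of_nat q)
         + replicate_mset (q * (q + 1) * (q - 2))
             ((of_nat q)^2 - 2 * of_nat q + 1)
       \<and> Q_Spec (commuting_graph (general_linear_group 2 TYPE('a))) =
           replicate_mset (q * (q + 1) div 2)
             (2 * (of_nat q)^2 - 6 * of_nat q + 2)
         + replicate_mset (q * (q + 1) * (q^2 - 3 * q + 1) div 2)
             ((of_nat q)^2 - 3 * of_nat q)
         + replicate_mset (q * (q - 1) div 2)
             (2 * (of_nat q)^2 - 2 * of_nat q - 2)
         + replicate_mset (q * (q - 1) * (q^2 - q - 1) div 2)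
             ((of_nat q)^2 - of_nat q - 2)
         + replicate_mset (q + 1)
             (2 * (of_nat q)^2 - 4 * of_nat q)
         + replicate_mset (q * (q + 1) * (q - 2))
             ((of_nat q)^2 - 2 * of_nat q - 1)"
proof -
  let ?G = "general_linear_group 2 TYPE('a)"
  define m0 m1 m2 where "m0 = (q - 1) * q" and "m1 = (q - 1) * (q - 1)" and "m2 = (q - 1) * (q - 2)"
  define N0 N2 where "N0 = q * (q - 1) div 2" and "N2 = q * (q + 1) div 2"
  \<comment> \<open>With \<open>q = r + 3\<close>, natural differences such as
    \<open>q^2 - 3 * q\<close> become polynomials in \<open>r\<close> without truncation.\<close>
  obtain r where r: "q = r + 3" using \<open>q > 2\<close> by (metis Suc_leI add.commute le_Suc_ex eval_nat_numeral(3))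
  have of_nat: "of_nat m0 = (of_nat q ^ 2 - of_nat q :: complex)"
    "of_nat m1 = (of_nat q ^ 2 - 2 * of_nat q + 1 :: complex)"
    "of_nat m2 = (of_nat q ^ 2 - 3 * of_nat q + 2 :: complex)"
    by (simp_all add: m0_def m1_def m2_def r power2_eq_square algebra_simps)
  have even: "2 * N0 = q * (q - 1)" "2 * N2 = q * (q + 1)"
    unfolding N0_def N2_def using r by (auto intro!: even_two_times_div_two)
  have mult: "N2 * (m2 - 1) = q * (q + 1) * (q^2 - 3 * q + 1) div 2"
    "N0 * (m0 - 1) = q * (q - 1) * (q^2 - q - 1) div 2"
    "(q + 1) * (m1 - 1) = q * (q + 1) * (q - 2)"
    "N0 + N2 + (q + 1) = q^2 + q + 1"
  proof -
    have m: "m2 - 1 = q^2 - 3 * q + 1" "m0 - 1 = q^2 - q - 1" "m1 - 1 = q * (q - 2)"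
      by (simp_all add: m0_def m1_def m2_def r power2_eq_square algebra_simps)
    \<comment> \<open>The target exponents halve a whole product; its leading factor is
      \<open>2 * N2\<close> or \<open>2 * N0\<close>, so the division is exact.\<close>
    have half: "2 * a * b div 2 = a * b" for a b :: nat by (simp add: mult.assoc)
    show "N2 * (m2 - 1) = q * (q + 1) * (q^2 - 3 * q + 1) div 2"
      "N0 * (m0 - 1) = q * (q - 1) * (q^2 - q - 1) div 2"
      unfolding m even[symmetric] half by (rule refl)+
    show "(q + 1) * (m1 - 1) = q * (q + 1) * (q - 2)"
      unfolding m by (simp only: mult_ac)
    \<comment> \<open>The multiplicity of the Laplacian eigenvalue 0 is the number of cliques, which
      is the number of points of the projective plane.\<close>
    have "2 * (N0 + N2 + (q + 1)) = 2 * (q^2 + q + 1)"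
      using even by (simp add: r power2_eq_square algebra_simps)
    thus "N0 + N2 + (q + 1) = q^2 + q + 1" by simp
  qed
  note spec = L_Q_Spec_commuting_graph[OF finite_GL2[where 'a = 'a] commutation_transitive_GL2]
  have "CARD('a) > 2" using assms by simp
  note classes = sum_commuting_classes_GL2[OF this, unfolded \<open>CARD('a) = q\<close>,
      folded m0_def m1_def m2_def N0_def N2_def]
  have L: "L_Spec (commuting_graph ?G) =
      replicate_mset (N0 + N2 + (q + 1)) 0 + replicate_mset (N2 * (m2 - 1)) (of_nat m2) +
      replicate_mset (N0 * (m0 - 1)) (of_nat m0) +
      replicate_mset ((q + 1) * (m1 - 1)) (of_nat m1)"
    unfolding spec(1) classes[where h = "\<lambda>m. replicate_mset (m - 1) (of_nat m) + {#0#}"]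
      repeat_mset_distrib2 repeat_mset_replicate repeat_mset_replicate_mset
    by (simp only: replicate_mset_add add_ac)
  have Q: "Q_Spec (commuting_graph ?G) =
      replicate_mset N2 (2 * of_nat m2 - 2) + replicate_mset (N2 * (m2 - 1)) (of_nat m2 - 2) +
      replicate_mset N0 (2 * of_nat m0 - 2) + replicate_mset (N0 * (m0 - 1)) (of_nat m0 - 2) +
      replicate_mset (q + 1) (2 * of_nat m1 - 2) +
      replicate_mset ((q + 1) * (m1 - 1)) (of_nat m1 - 2)"
    unfolding spec(2)
      classes[where h = "\<lambda>m. replicate_mset (m - 1) (of_nat m - 2) + {#2 * of_nat m - 2#}"]
      repeat_mset_distrib2 repeat_mset_replicate repeat_mset_replicate_mset
    by (simp only: add_ac)
  have "2 * (x ^ 2 - 3 * x + 2) - 2 = 2 * x ^ 2 - 6 * x + (2 :: complex)"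
    "x ^ 2 - 3 * x + 2 - 2 = x ^ 2 - 3 * x" "2 * (x ^ 2 - x) - 2 = 2 * x ^ 2 - 2 * x - 2"
    "2 * (x ^ 2 - 2 * x + 1) - 2 = 2 * x ^ 2 - 4 * x" "x ^ 2 - 2 * x + 1 - 2 = x ^ 2 - 2 * x - 1"
    for x :: complex
    by (simp_all add: algebra_simps)
  thus ?thesis unfolding L Q mult of_nat unfolding N0_def N2_def by (simp only: simp_thms)
qed

end
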